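(* Let $A_1,\ldots,A_k\in\mathcal{M}_q$ be positive matrices with $mI\leq A_i\leq MI$ for $i=1,\ldots,k$ and some scalars $0<m<M$. Let $\Phi:\mathcal{M}_q^k\to\mathcal{M}_p$ be a unital positive multilinear map. If a real valued continuous function $f$ is super-multiplicative and convex on $[m,M]$, then $$\Phi(f(A_1),\ldots,f(A_k))\leq\alpha(m^k,M^k,f)\,f(\Phi(A_1,\ldots,A_k)).$$ Respectively, if a real valued continuous function $f$ is sub-multiplicative and concave on $[m,M]$, then $$\beta(m^k,M^k,f)\,f(\Phi(A_1,\ldots,A_k))\leq\Phi(f(A_1),\ldots,f(A_k)).$$
   Context: $\mathcal{M}_p$ is the algebra of $p\times p$ complex matrices with identity $I$. A matrix $A$ is positive ($A\geq0$) if it is Hermitian with all eigenvalues nonnegative; $A\leq B$ means $B-A\geq0$. A map $\Phi:\mathcal{M}_q^k\to\mathcal{M}_p$ is multilinear if it is linear in each of its variables; positive if $\Phi(A_1,\ldots,A_k)\geq0$ whenever all $A_i\geq0$; unital if $\Phi(I,\ldots,I)=I$. A real valued continuous function $f$ is super-multiplicative on an interval $J$ if $f(xy)\geq f(x)f(y)$ for all $x,y\in J$, and sub-multiplicative on $J$ if $f(xy)\leq f(x)f(y)$ for all $x,y\in J$. Convex and concave are meant in the ordinary scalar sense. The constants are introduced, for scalars $0<a<b$ and a real valued continuous function $f$ with $f(t)>0$ on $[a,b]$, by $$\alpha(a,b,f)=\max_{a\leq t\leq b}\frac{1}{f(t)}\left(\frac{f(b)-f(a)}{b-a}(t-a)+f(a)\right),\qquad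 \beta(a,b,f)=\min_{a\leq t\leq b}\frac{1}{f(t)}\left(\frac{f(b)-f(a)}{b-a}(t-a)+f(a)\right).$$
   Formalization: As printed the claim fails (e.g. k=3); here f is continuous, super-multiplicative and convex (resp. sub-multiplicative and concave) on an interval J containing both [m,M] and [m^k,M^k], and in the sub-multiplicative case f≥0 on [m,M] is also assumed. *)

theory Defs
  imports "HOL-Analysis.Analysis"
begin

(* M_n is the type complex^'n^'n, with n = CARD('n); the identity matrix is mat 1. *)

definition cadjoint :: "complex^'n^'m \<Rightarrow> complex^'m^'n"
  where "cadjoint A = map_matrix cnj (transpose A)"

definition hermitian_matrix :: "complex^'n^'n \<Rightarrow> bool"
  where "hermitian_matrix A \<longleftrightarrow> cadjoint A = A"

definition unitary_matrix :: "complex^'n^'n \<Rightarrow> bool"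
  where "unitary_matrix U \<longleftrightarrow> cadjoint U ** U = mat 1 \<and> U ** cadjoint U = mat 1"

definition eigenvalue_of :: "complex^'n^'n \<Rightarrow> complex \<Rightarrow> bool"
  where "eigenvalue_of A c \<longleftrightarrow> (\<exists>v. v \<noteq> 0 \<and> A *v v = c *s v)"

definition positive_matrix :: "complex^'n^'n \<Rightarrow> bool"
  where "positive_matrix A \<longleftrightarrow>
    hermitian_matrix A \<and> (\<forall>c. eigenvalue_of A c \<longrightarrow> c \<in> \<real> \<and> 0 \<le> Re c)"

definition loewner_le :: "complex^'n^'n \<Rightarrow> complex^'n^'n \<Rightarrow> bool"  (infix "\<preceq>" 50)
  where "A \<preceq> B \<longleftrightarrow> positive_matrix (B - A)"

definition diag_matrix :: "('n \<Rightarrow> real) \<Rightarrow> complex^'n^'n"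
  where "diag_matrix d = (\<chi> i j. if i = j then complex_of_real (d i) else 0)"

(* The functional calculus f(A) for Hermitian A. By the spectral theorem a decomposition
   A = U diag(d) U* exists, and U diag(f d) U* does not depend on which one is chosen.
   For A that is not Hermitian the value is unspecified. *)
definition matrix_fun :: "(real \<Rightarrow> real) \<Rightarrow> complex^'n^'n \<Rightarrow> complex^'n^'n"
  where "matrix_fun f A = (THE B. \<exists>U d. unitary_matrix U
      \<and> A = U ** diag_matrix d ** cadjoint U
      \<and> B = U ** diag_matrix (f \<circ> d) ** cadjoint U)"

(* Multiplication by a complex scalar; the vector-space structure that the library puts on
   complex^'n^'n is only the real one. *)
definition cscale :: "complex \<Rightarrow> complex^'n^'m \<Rightarrow> complex^'n^'m"
  where "cscale c A = map_matrix ((*) c) A"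

(* A k-tuple of matrices is a function on a finite index type 'k with CARD('k) = k. *)
definition multilinear_map :: "(('k::finite \<Rightarrow> complex^'q^'q) \<Rightarrow> complex^'p^'p) \<Rightarrow> bool"
  where "multilinear_map \<Phi> \<longleftrightarrow>
    (\<forall>A i X Y. \<Phi> (A(i := X + Y)) = \<Phi> (A(i := X)) + \<Phi> (A(i := Y))) \<and>
    (\<forall>A i c X. \<Phi> (A(i := cscale c X)) = cscale c (\<Phi> (A(i := X))))"

definition positive_map :: "(('k::finite \<Rightarrow> complex^'q^'q) \<Rightarrow> complex^'p^'p) \<Rightarrow> bool"
  where "positive_map \<Phi> \<longleftrightarrow> (\<forall>A. (\<forall>i. positive_matrix (A i)) \<longrightarrow> positive_matrix (\<Phi> A))"

definition unital_map :: "(('k::finite \<Rightarrow> complex^'q^'q) \<Rightarrow> complex^'p^'p) \<Rightarrow> bool"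
  where "unital_map \<Phi> \<longleftrightarrow> \<Phi> (\<lambda>i. mat 1) = mat 1"

definition super_multiplicative_on :: "real set \<Rightarrow> (real \<Rightarrow> real) \<Rightarrow> bool"
  where "super_multiplicative_on J f \<longleftrightarrow> (\<forall>x\<in>J. \<forall>y\<in>J. f (x * y) \<ge> f x * f y)"

definition sub_multiplicative_on :: "real set \<Rightarrow> (real \<Rightarrow> real) \<Rightarrow> bool"
  where "sub_multiplicative_on J f \<longleftrightarrow> (\<forall>x\<in>J. \<forall>y\<in>J. f (x * y) \<le> f x * f y)"

(* For f continuous and positive on [a,b] the quotient is continuous there, so the supremum
   and the infimum over the compact interval are attained: they are the max and the min. *)
definition alpha_const :: "real \<Rightarrow> real \<Rightarrow> (real \<Rightarrow> real) \<Rightarrow> real"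
  where "alpha_const a b f =
    (SUP t\<in>{a..b}. 1 / f t * ((f b - f a) / (b - a) * (t - a) + f a))"

definition beta_const :: "real \<Rightarrow> real \<Rightarrow> (real \<Rightarrow> real) \<Rightarrow> real"
  where "beta_const a b f =
    (INF t\<in>{a..b}. 1 / f t * ((f b - f a) / (b - a) * (t - a) + f a))"

end

theory Submission
  imports Defs
begin

text \<open>
The spectral theorem writes each \<open>A i\<close> as \<open>\<Sum>j. d i j *\<^sub>R P i j\<close> with positive \<open>P i j\<close> summing to the
identity. Expanding \<open>\<Phi>\<close> in all its variables gives, for every function \<open>f\<close> at once,
\<open>\<Phi> (f (A 1), \<dots>, f (A k)) = \<Sum>g. (\<Prod>i. f (d i (g i))) *\<^sub>R Q g\<close>, where \<open>g\<close> ranges over the choices of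
one index per variable and \<open>Q g = \<Phi> (P 1 (g 1), \<dots>, P k (g k))\<close>. Positivity and unitality of \<open>\<Phi>\<close> make
the \<open>Q g\<close> positive with sum the identity, so an inequality between scalar coefficients becomes a
Loewner inequality (\<open>multilinear_resolution\<close>, \<open>loewner_le_sum\<close>).

Let \<open>L\<close> be the affine function whose graph is the chord of \<open>f\<close> over \<open>[m ^ k, M ^ k]\<close>. If \<open>f\<close> is
super-multiplicative and convex, then
\<open>\<Prod>i. f (x i) \<le> f (\<Prod>i. x i) \<le> L (\<Prod>i. x i)\<close> for \<open>x i \<in> [m, M]\<close>, hence
\<open>\<Phi> (f (A 1), \<dots>, f (A k)) \<preceq> \<Sum>g. L (\<Prod>i. d i (g i)) *\<^sub>R Q g\<close>. Since \<open>L\<close> is affine, the right-hand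
side depends only on \<open>\<Sum>g. (\<Prod>i. d i (g i)) *\<^sub>R Q g = \<Phi> A\<close> and on the sum of the \<open>Q g\<close>; it is
therefore also \<open>L\<close> applied to \<open>\<Phi> A\<close> by the functional calculus. The spectrum of \<open>\<Phi> A\<close> lies in
\<open>[m ^ k, M ^ k]\<close>, and on this interval \<open>L \<le> \<alpha> f\<close> because \<open>\<alpha>\<close> is the maximum of \<open>L / f\<close>. The
sub-multiplicative concave case reverses every inequality and replaces the maximum by the minimum.

Two scalar points need care. Partial products of the \<open>x i\<close> must stay in \<open>J\<close>
(\<open>prod_mem_interval\<close>), and a super-multiplicative \<open>f\<close> may be negative on \<open>[m, M]\<close>, so that
\<open>\<Prod>i. f (x i) \<le> f (\<Prod>i. x i)\<close> does not follow by multiplying in one factor after another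
(\<open>super_multiplicative_prod\<close>).
\<close>

section \<open>Hermitian matrices\<close>

text \<open>The Hermitian inner product. Its real part is the inner product that \<open>complex^'n\<close> carries as a
real Euclidean space; orthonormality has to refer to the complex one.\<close>
definition hdot :: "complex^'n \<Rightarrow> complex^'n \<Rightarrow> complex"
  where "hdot x y = (\<Sum>i\<in>UNIV. cnj (x $ i) * y $ i)"

lemma Re_hdot: "Re (hdot x y) = x \<bullet> y"
  by (simp add: hdot_def inner_vec_def inner_complex_def)

lemma hdot_self: "hdot x x = complex_of_real (x \<bullet> x)"
proof -
  have "cnj (x $ i) * x $ i = complex_of_real (x $ i \<bullet> x $ i)" for i
    by (simp add: complex_eq_iff inner_complex_def)
  then show ?thesis
    by (simp add: hdot_def inner_vec_def)
qed

lemma cadjoint_nth [simp]: "cadjoint A $ i $ j = cnj (A $ j $ i)"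
  by (simp add: cadjoint_def map_matrix_def transpose_def)

lemma cadjoint_cadjoint [simp]: "cadjoint (cadjoint A) = A"
  by (simp add: vec_eq_iff)

lemma cadjoint_mult: "cadjoint (A ** B) = cadjoint B ** cadjoint A"
  by (simp add: vec_eq_iff matrix_matrix_mult_def mult.commute)

lemma hdot_adjoint: "hdot x (A *v y) = hdot (cadjoint A *v x) y"
proof -
  have "hdot x (A *v y) = (\<Sum>i\<in>UNIV. \<Sum>j\<in>UNIV. cnj (x $ i) * (A $ i $ j * y $ j))"
    by (simp add: hdot_def matrix_vector_mult_def sum_distrib_left)
  also have "\<dots> = (\<Sum>j\<in>UNIV. \<Sum>i\<in>UNIV. cnj (x $ i) * (A $ i $ j * y $ j))"
    by (rule sum.swap)
  also have "\<dots> = hdot (cadjoint A *v x) y"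
    by (simp add: hdot_def matrix_vector_mult_def sum_distrib_left sum_distrib_right
        mult_ac)
  finally show ?thesis .
qed

lemma inner_adjoint: "x \<bullet> (A *v y) = (cadjoint A *v x) \<bullet> (y :: complex^'n)"
  using hdot_adjoint[of x A y] by (metis Re_hdot)

lemma hermitian_inner: "hermitian_matrix A \<Longrightarrow> x \<bullet> (A *v y) = (A *v x) \<bullet> y"
  by (simp add: inner_adjoint hermitian_matrix_def)

lemma hermitian_conjugate: "hermitian_matrix B \<Longrightarrow> hermitian_matrix (U ** B ** cadjoint U)"
  by (simp add: hermitian_matrix_def cadjoint_mult matrix_mul_assoc)

lemma hermitian_diag: "hermitian_matrix (diag_matrix d)"
  by (auto simp: hermitian_matrix_def vec_eq_iff diag_matrix_def)

lemma hermitian_add: "hermitian_matrix A \<Longrightarrow> hermitian_matrix B \<Longrightarrow> hermitian_matrix (A + B)"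
  by (simp add: hermitian_matrix_def vec_eq_iff)

lemma hermitian_scaleR: "hermitian_matrix A \<Longrightarrow> hermitian_matrix (c *\<^sub>R A)"
  by (simp add: hermitian_matrix_def vec_eq_iff)

section \<open>The spectral theorem\<close>

text \<open>
A maximiser \<open>v\<close> of the Rayleigh quotient over the unit sphere of \<open>W\<close> is an eigenvector. With \<open>l\<close>
the maximum, \<open>x \<mapsto> l * (x \<bullet> x) - x \<bullet> T x\<close> is a nonnegative quadratic form on \<open>W\<close> that vanishes at
\<open>v\<close>, so its derivative at \<open>v\<close> in every direction of \<open>W\<close> is zero; the direction \<open>l *\<^sub>R v - T v\<close> gives
the claim.
\<close>
lemma selfadjoint_eigenvector_in_subspace:
  fixes T :: "'a::euclidean_space \<Rightarrow> 'a"
  assumes T: "linear T" and sym: "\<And>x y. x \<bullet> T y = T x \<bullet> y"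
    and W: "subspace W" "\<And>x. x \<in> W \<Longrightarrow> T x \<in> W"
    and w: "w \<in> W" "w \<noteq> 0"
  shows "\<exists>v l. v \<in> W \<and> norm v = 1 \<and> T v = l *\<^sub>R v"
proof -
  have "compact (sphere 0 1 \<inter> W)"
    by (intro compact_Int_closed closed_subspace W) simp
  moreover have "(1 / norm w) *\<^sub>R w \<in> sphere 0 1 \<inter> W"
    using w W(1) by (simp add: subspace_scale)
  then have "sphere 0 1 \<inter> W \<noteq> {}" by blast
  moreover have "continuous_on (sphere 0 1 \<inter> W) (\<lambda>x. x \<bullet> T x)"
    using T by (intro continuous_intros linear_continuous_on linear_conv_bounded_linear[THEN iffD1])
  ultimately obtain v where v: "v \<in> W" "norm v = 1"
    and vmax: "\<And>x. x \<in> W \<Longrightarrow> norm x = 1 \<Longrightarrow> x \<bullet> T x \<le> v \<bullet> T v"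
    by (metis (no_types, lifting) IntE IntI continuous_attains_sup mem_sphere_0)
  define l where "l = v \<bullet> T v"
  have nonneg: "0 \<le> l * (x \<bullet> x) - x \<bullet> T x" if "x \<in> W" for x
  proof (cases "x = 0")
    case False
    let ?u = "(1 / norm x) *\<^sub>R x"
    have "?u \<bullet> T ?u \<le> l"
      unfolding l_def using False that W(1) by (intro vmax) (simp_all add: subspace_scale)
    then show ?thesis
      using False by (simp add: linear_cmul[OF T] field_simps power2_norm_eq_inner flip: power2_eq_square)
  qed simp
  \<comment> \<open>The form along the line \<open>v + t *\<^sub>R y\<close> is a quadratic in \<open>t\<close> with no constant term.\<close>
  define y where "y = l *\<^sub>R v - T v"
  have y: "y \<in> W"
    unfolding y_def using W v by (simp add: subspace_diff subspace_scale)
  have quad: "0 \<le> 2 * t * (y \<bullet> y) + t\<^sup>2 * (l * (y \<bullet> y) - y \<bullet> T y)" for t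
  proof -
    have "v + t *\<^sub>R y \<in> W"
      using W(1) v y by (simp add: subspace_add subspace_scale)
    note nonneg[OF this]
    also have "l * ((v + t *\<^sub>R y) \<bullet> (v + t *\<^sub>R y)) - (v + t *\<^sub>R y) \<bullet> T (v + t *\<^sub>R y)
      = (l * (v \<bullet> v) - v \<bullet> T v) + 2 * t * (y \<bullet> (l *\<^sub>R v - T v)) + t\<^sup>2 * (l * (y \<bullet> y) - y \<bullet> T y)"
      using sym[of v y]
      by (simp add: linear_add[OF T] linear_cmul[OF T] algebra_simps inner_commute power2_eq_square)
    also have "l * (v \<bullet> v) - v \<bullet> T v = 0"
      using v by (simp add: l_def flip: power2_norm_eq_inner)
    finally show ?thesis by (simp add: y_def)
  qed
  have "y \<bullet> y = 0"
  proof (rule ccontr)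
    assume "y \<bullet> y \<noteq> 0"
    then have a: "y \<bullet> y > 0" by simp
    define b where "b = l * (y \<bullet> y) - y \<bullet> T y"
    have b: "b \<ge> 0" using nonneg[OF y] by (simp add: b_def)
    \<comment> \<open>This negative \<open>t\<close> makes the linear term outweigh the quadratic one, whatever the size of \<open>b\<close>.\<close>
    define t where "t = - (y \<bullet> y) / (b + 1)"
    have t: "t * (b + 1) = - (y \<bullet> y)"
      using b by (simp add: t_def)
    have "0 \<le> (2 * t * (y \<bullet> y) + t\<^sup>2 * b) * (b + 1)\<^sup>2"
      using quad[of t] by (simp add: b_def)
    also have "\<dots> = 2 * (t * (b + 1)) * (y \<bullet> y) * (b + 1) + (t * (b + 1))\<^sup>2 * b"
      by (simp add: algebra_simps power2_eq_square)
    also have "\<dots> = - ((y \<bullet> y)\<^sup>2 * (b + 2))"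
      unfolding t by (simp add: algebra_simps power2_eq_square)
    also have "\<dots> < 0" using a b by simp
    finally show False by simp
  qed
  then show ?thesis
    using v by (intro exI[of _ v] exI[of _ l]) (simp add: y_def)
qed

text \<open>
Indexing the eigenvectors by a growing set of matrix indices makes the complete family the columns
of a square matrix. While an index is left, the orthogonal complement \<open>W\<close> of the vectors found so
far is nonzero and invariant, so it contains a further eigenvector.
\<close>
lemma orthonormal_eigenvectors:
  fixes A :: "complex^'n^'n" and I :: "'n set"
  assumes A: "hermitian_matrix A"
  shows "\<exists>v d. (\<forall>i\<in>I. A *v v i = complex_of_real (d i) *s v i) \<and>
    (\<forall>i\<in>I. \<forall>j\<in>I. hdot (v i) (v j) = (if i = j then 1 else 0))"
proof -
  have "finite I" by simp
  then show ?thesis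
  proof (induction I)
    case empty
    show ?case by simp
  next
    case (insert k I)
    then obtain v d where ev: "\<And>i. i \<in> I \<Longrightarrow> A *v v i = complex_of_real (d i) *s v i"
      and on: "\<And>i j. i \<in> I \<Longrightarrow> j \<in> I \<Longrightarrow> hdot (v i) (v j) = (if i = j then 1 else 0)"
      by blast
    define W where "W = {x. \<forall>i\<in>I. hdot (v i) x = 0}"
    define B :: "complex^'n^'n" where "B = (\<chi> i j. if i \<in> I then cnj (v i $ j) else 0)"
    \<comment> \<open>Row \<open>k\<close> of \<open>B\<close> is zero, so \<open>B\<close> is singular; its kernel lies in \<open>W\<close>.\<close>
    have "\<nexists>C. C ** B = mat 1"
    proof
      assume "\<exists>C. C ** B = mat 1"
      then obtain C where "B ** C = mat 1"
        using matrix_left_right_inverse by blast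
      then have "(B ** C) $ k $ k = 1" by (simp add: mat_def)
      then show False
        using insert.hyps by (simp add: B_def matrix_matrix_mult_def)
    qed
    then obtain w where w: "w \<noteq> 0" "B *v w = 0"
      using matrix_left_invertible_ker by blast
    have "hdot (v i) w = (B *v w) $ i" if "i \<in> I" for i
      using that by (simp add: hdot_def B_def matrix_vector_mult_def)
    then have wW: "w \<in> W"
      using w by (simp add: W_def)
    have W: "subspace W"
      by (auto simp: subspace_def W_def hdot_def algebra_simps sum.distrib
          simp flip: scaleR_sum_right sum_distrib_left)
    have inv: "A *v x \<in> W" if "x \<in> W" for x
    proof -
      have "hdot (v i) (A *v x) = 0" if "i \<in> I" for i
      proof -
        have "hdot (v i) (A *v x) = hdot (complex_of_real (d i) *s v i) x"
          using A ev[OF that] by (simp add: hdot_adjoint hermitian_matrix_def)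
        also have "\<dots> = complex_of_real (d i) * hdot (v i) x"
          by (simp add: hdot_def sum_distrib_left mult.assoc)
        finally show ?thesis
          using \<open>x \<in> W\<close> that by (simp add: W_def)
      qed
      then show ?thesis by (simp add: W_def)
    qed
    have lin: "linear ((*v) A)"
    proof (rule linearI)
      show "A *v (c *\<^sub>R x) = c *\<^sub>R (A *v x)" for c x
        by (simp add: vec_eq_iff matrix_vector_mult_def scaleR_sum_right)
    qed (rule matrix_vector_right_distrib)
    obtain u l where u: "u \<in> W" "norm u = 1" "A *v u = l *\<^sub>R u"
      using selfadjoint_eigenvector_in_subspace[OF lin hermitian_inner[OF A] W inv wW w(1)]
      by blast
    have uu: "hdot u u = 1"
      using u(2) by (simp add: hdot_self flip: power2_norm_eq_inner)
    have vu: "hdot (v i) u = 0" "hdot u (v i) = 0" if "i \<in> I" for i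
    proof -
      show "hdot (v i) u = 0" using u that by (simp add: W_def)
      moreover have "hdot u (v i) = cnj (hdot (v i) u)"
        by (simp add: hdot_def mult.commute)
      ultimately show "hdot u (v i) = 0" by simp
    qed
    have "A *v u = complex_of_real l *s u"
      using u(3) by (simp add: vec_eq_iff scaleR_conv_of_real[where 'a=complex])
    then show ?case
      using insert.hyps ev on uu vu
      by (intro exI[of _ "v(k := u)"] exI[of _ "d(k := l)"]) auto
  qed
qed

theorem hermitian_diagonalizable:
  fixes A :: "complex^'n^'n"
  assumes A: "hermitian_matrix A"
  obtains U d where "unitary_matrix U" "A = U ** diag_matrix d ** cadjoint U"
proof -
  obtain v :: "'n \<Rightarrow> complex^'n" and d :: "'n \<Rightarrow> real"
    where ev: "\<And>i. A *v v i = complex_of_real (d i) *s v i"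
      and on: "\<And>i j. hdot (v i) (v j) = (if i = j then 1 else 0)"
    using orthonormal_eigenvectors[OF A, of UNIV] by auto
  define U where "U = (\<chi> i j. v j $ i)"
  have 1: "cadjoint U ** U = mat 1"
    using on by (simp add: vec_eq_iff U_def matrix_matrix_mult_def mat_def hdot_def)
  then have 2: "U ** cadjoint U = mat 1"
    using matrix_left_right_inverse by blast
  have "(A ** U) $ i $ j = (U ** diag_matrix d) $ i $ j" for i j
  proof -
    have "(A ** U) $ i $ j = (A *v v j) $ i"
      by (simp add: U_def matrix_matrix_mult_def matrix_vector_mult_def)
    also have "\<dots> = (U ** diag_matrix d) $ i $ j"
      by (simp add: ev U_def matrix_matrix_mult_def diag_matrix_def if_distrib[of "\<lambda>x. _ * x"] mult.commute
          cong: if_cong)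
    finally show ?thesis .
  qed
  then have "A ** U = U ** diag_matrix d"
    by (simp add: vec_eq_iff)
  then have "A = U ** diag_matrix d ** cadjoint U"
    by (metis 2 matrix_mul_assoc matrix_mul_rid)
  moreover have "unitary_matrix U"
    using 1 2 by (simp add: unitary_matrix_def)
  ultimately show thesis
    by (intro that)
qed

section \<open>The functional calculus\<close>

lemma matrix_add_rdistrib: "(B + C) ** (A :: complex^'n^'m) = B ** A + C ** A"
  by (simp add: vec_eq_iff matrix_matrix_mult_def sum.distrib distrib_right)

lemma diag_matrix_mult_nth:
  "(diag_matrix d ** B) $ i $ j = complex_of_real (d i) * B $ i $ j"
  "(B ** diag_matrix d) $ i $ j = B $ i $ j * complex_of_real (d j)"
  by (simp_all add: matrix_matrix_mult_def diag_matrix_def if_distrib[of "\<lambda>x. _ * x"]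
      if_distrib[of "\<lambda>x. x * _"] cong: if_cong)

text \<open>
If \<open>V\<close> and \<open>U\<close> both diagonalise the matrix, \<open>W = cadjoint V ** U\<close> intertwines the two diagonal
matrices: an entry of \<open>W\<close> is zero unless the eigenvalues at its row and column agree. This is
preserved when \<open>f\<close> is applied to the eigenvalues, so the value does not depend on the choice.
\<close>
lemma matrix_fun_diagonalized:
  assumes U: "unitary_matrix U"
  shows "matrix_fun f (U ** diag_matrix d ** cadjoint U) = U ** diag_matrix (f \<circ> d) ** cadjoint U"
  unfolding matrix_fun_def
proof (rule the_equality)
  show "\<exists>V e. unitary_matrix V \<and> U ** diag_matrix d ** cadjoint U = V ** diag_matrix e ** cadjoint V \<and>
      U ** diag_matrix (f \<circ> d) ** cadjoint U = V ** diag_matrix (f \<circ> e) ** cadjoint V"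
    using U by blast
next
  fix B
  assume "\<exists>V e. unitary_matrix V \<and> U ** diag_matrix d ** cadjoint U = V ** diag_matrix e ** cadjoint V \<and>
      B = V ** diag_matrix (f \<circ> e) ** cadjoint V"
  then obtain V e where V: "unitary_matrix V"
    and eq: "U ** diag_matrix d ** cadjoint U = V ** diag_matrix e ** cadjoint V"
    and B: "B = V ** diag_matrix (f \<circ> e) ** cadjoint V"
    by blast
  define W where "W = cadjoint V ** U"
  have "cadjoint V ** (U ** diag_matrix d ** cadjoint U) ** U =
      cadjoint V ** (V ** diag_matrix e ** cadjoint V) ** U"
    by (simp add: eq)
  moreover have "cadjoint V ** (U ** diag_matrix d ** cadjoint U) ** U = W ** diag_matrix d"
    using U by (simp add: W_def unitary_matrix_def flip: matrix_mul_assoc)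
  moreover have "cadjoint V ** (V ** diag_matrix e ** cadjoint V) ** U = diag_matrix e ** W"
    using V by (simp add: W_def unitary_matrix_def matrix_mul_assoc)
  ultimately have *: "W ** diag_matrix d = diag_matrix e ** W" by simp
  have "W $ i $ j * complex_of_real (f (d j)) = complex_of_real (f (e i)) * W $ i $ j" for i j
  proof -
    have "W $ i $ j * complex_of_real (d j) = complex_of_real (e i) * W $ i $ j"
      using arg_cong[OF *, of "\<lambda>B. B $ i $ j"] by (simp add: diag_matrix_mult_nth)
    then have "W $ i $ j = 0 \<or> d j = e i" by auto
    then show ?thesis by auto
  qed
  then have W: "W ** diag_matrix (f \<circ> d) = diag_matrix (f \<circ> e) ** W"
    by (simp add: vec_eq_iff diag_matrix_mult_nth)
  have "B = V ** (diag_matrix (f \<circ> e) ** W) ** cadjoint U"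
    using U by (simp add: B W_def unitary_matrix_def flip: matrix_mul_assoc)
  also have "\<dots> = U ** diag_matrix (f \<circ> d) ** cadjoint U"
    unfolding W[symmetric] using V by (simp add: W_def unitary_matrix_def matrix_mul_assoc)
  finally show "B = U ** diag_matrix (f \<circ> d) ** cadjoint U" .
qed

section \<open>Positive matrices and the Loewner order\<close>

lemma matrix_vector_scaleR: "(c *\<^sub>R B) *v x = c *\<^sub>R (B *v (x :: complex^'n))"
  by (simp add: vec_eq_iff matrix_vector_mult_def scaleR_sum_right)

lemma matrix_vector_mult_smult: "B *v (c *s x) = c *s (B *v (x :: complex^'n))"
  by (simp add: vec_eq_iff matrix_vector_mult_def sum_distrib_left mult_ac)

lemma diag_vec_nth: "(diag_matrix d *v x) $ i = d i *\<^sub>R (x $ i)"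
  by (simp add: matrix_vector_mult_def diag_matrix_def if_distrib[of "\<lambda>z. z * _"] scaleR_conv_of_real[where 'a=complex]
      cong: if_cong)

lemma eigenvalue_diagonalized:
  assumes U: "unitary_matrix U"
  shows "eigenvalue_of (U ** diag_matrix d ** cadjoint U) (complex_of_real (d j))"
proof -
  define e :: "complex^'a" where "e = axis j 1"
  have e: "cadjoint U *v (U *v e) = e"
    using U by (simp add: matrix_vector_mul_assoc unitary_matrix_def)
  have "diag_matrix d *v e = complex_of_real (d j) *s e"
    by (auto simp: vec_eq_iff diag_vec_nth e_def axis_def scaleR_conv_of_real[where 'a=complex])
  then have "(U ** diag_matrix d ** cadjoint U) *v (U *v e) = complex_of_real (d j) *s (U *v e)"
    by (simp add: e matrix_vector_mult_smult flip: matrix_vector_mul_assoc)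
  moreover have "U *v e \<noteq> 0"
    using e by (auto simp: e_def axis_eq_0_iff)
  ultimately show ?thesis
    unfolding eigenvalue_of_def by blast
qed

lemma conjugate_inner:
  "x \<bullet> ((U ** B ** cadjoint U) *v x) = (cadjoint U *v x) \<bullet> (B *v (cadjoint U *v x))"
  by (simp add: inner_adjoint[of x U] flip: matrix_vector_mul_assoc)

lemma diag_inner_nonneg: "(\<And>i. 0 \<le> d i) \<Longrightarrow> 0 \<le> x \<bullet> (diag_matrix d *v x)"
  by (simp add: inner_vec_def diag_vec_nth sum_nonneg)

text \<open>
Unlike the condition on eigenvalues, nonnegativity of the quadratic form is visibly inherited by
sums and nonnegative multiples. The real inner product suffices, since \<open>hdot x (A *v x)\<close> is real
for Hermitian \<open>A\<close>.
\<close>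
lemma positive_matrix_iff_form:
  fixes A :: "complex^'n^'n"
  shows "positive_matrix A \<longleftrightarrow> hermitian_matrix A \<and> (\<forall>x. 0 \<le> x \<bullet> (A *v x))"
proof (intro iffI conjI allI)
  assume pos: "positive_matrix A"
  then show herm: "hermitian_matrix A"
    by (simp add: positive_matrix_def)
  fix x
  obtain U d where U: "unitary_matrix U" and A: "A = U ** diag_matrix d ** cadjoint U"
    using hermitian_diagonalizable[OF herm] .
  have "0 \<le> d i" for i
    using pos eigenvalue_diagonalized[OF U, of d i] unfolding A positive_matrix_def by force
  then show "0 \<le> x \<bullet> (A *v x)"
    unfolding A conjugate_inner by (rule diag_inner_nonneg)
next
  assume A: "hermitian_matrix A \<and> (\<forall>x. 0 \<le> x \<bullet> (A *v x))"
  have "c \<in> \<real> \<and> 0 \<le> Re c" if "eigenvalue_of A c" for c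
  proof -
    obtain v where v: "v \<noteq> 0" "A *v v = c *s v"
      using \<open>eigenvalue_of A c\<close> unfolding eigenvalue_of_def by blast
    have 1: "hdot v (A *v v) = c * hdot v v"
      unfolding v by (simp add: hdot_def sum_distrib_left mult_ac)
    have "hdot v (A *v v) = hdot (A *v v) v"
      using A by (simp add: hdot_adjoint hermitian_matrix_def)
    also have "\<dots> = cnj c * hdot v v"
      unfolding v by (simp add: hdot_def sum_distrib_left mult_ac)
    finally have "c = cnj c"
      using 1 v by (simp add: hdot_self)
    then have real: "c \<in> \<real>" by (simp add: complex_is_Real_iff complex_eq_iff)
    have "v \<bullet> (A *v v) = Re c * (v \<bullet> v)"
      unfolding Re_hdot[symmetric, of v "A *v v"] 1 by (simp add: hdot_self)
    then have "0 \<le> Re c * (v \<bullet> v)"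
      using A by metis
    moreover have "0 < v \<bullet> v" using v by simp
    ultimately have "0 \<le> Re c"
      by (simp add: zero_le_mult_iff del: inner_gt_zero_iff)
    with real show ?thesis by simp
  qed
  then show "positive_matrix A"
    using A by (simp add: positive_matrix_def)
qed

lemma positive_matrix_zero: "positive_matrix (0 :: complex^'n^'n)"
proof -
  have "hermitian_matrix (0 :: complex^'n^'n)"
    by (simp add: hermitian_matrix_def vec_eq_iff)
  then show ?thesis
    by (simp add: positive_matrix_iff_form)
qed

lemma positive_matrix_add: "positive_matrix A \<Longrightarrow> positive_matrix B \<Longrightarrow> positive_matrix (A + B)"
  by (simp add: positive_matrix_iff_form hermitian_add matrix_vector_mult_add_rdistrib inner_add_right)

lemma positive_matrix_scaleR: "0 \<le> c \<Longrightarrow> positive_matrix A \<Longrightarrow> positive_matrix (c *\<^sub>R A)"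
  by (simp add: positive_matrix_iff_form hermitian_scaleR matrix_vector_scaleR)

lemma positive_matrix_sum: "(\<And>i. i \<in> S \<Longrightarrow> positive_matrix (B i)) \<Longrightarrow> positive_matrix (\<Sum>i\<in>S. B i)"
  by (induction S rule: infinite_finite_induct)
    (simp_all add: positive_matrix_add positive_matrix_zero)

lemma loewner_le_trans: "A \<preceq> B \<Longrightarrow> B \<preceq> C \<Longrightarrow> A \<preceq> C"
  using positive_matrix_add[of "B - A" "C - B"] by (simp add: loewner_le_def)

lemma loewner_le_sum:
  assumes "\<And>i. positive_matrix (P i)" "\<And>i. i \<in> S \<Longrightarrow> c i \<le> c' i"
  shows "(\<Sum>i\<in>S. c i *\<^sub>R P i) \<preceq> (\<Sum>i\<in>S. c' i *\<^sub>R P i)"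
proof -
  have "positive_matrix (\<Sum>i\<in>S. (c' i - c i) *\<^sub>R P i)"
    using assms by (intro positive_matrix_sum positive_matrix_scaleR) auto
  then show ?thesis
    by (simp add: loewner_le_def scaleR_left_diff_distrib sum_subtractf)
qed

lemma hermitian_if_above_scalar:
  assumes "m *\<^sub>R mat 1 \<preceq> A"
  shows "hermitian_matrix A"
proof -
  have "hermitian_matrix (A - m *\<^sub>R mat 1)"
    using assms by (simp add: loewner_le_def positive_matrix_def)
  moreover have "hermitian_matrix (mat 1 :: complex^'a^'a)"
    by (simp add: hermitian_matrix_def vec_eq_iff mat_def)
  ultimately show ?thesis
    using hermitian_add[OF _ hermitian_scaleR[of "mat 1" m], of "A - m *\<^sub>R mat 1"] by simp
qed

lemma eigenvalue_bounds:
  assumes "m *\<^sub>R mat 1 \<preceq> A" "A \<preceq> M *\<^sub>R mat 1" "eigenvalue_of A (complex_of_real t)"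
  shows "t \<in> {m..M}"
proof -
  obtain v where v: "v \<noteq> 0" "A *v v = complex_of_real t *s v"
    using assms(3) unfolding eigenvalue_of_def by blast
  have tv: "A *v v = t *\<^sub>R v"
    by (simp add: v vec_eq_iff scaleR_conv_of_real[where 'a=complex])
  have "0 \<le> v \<bullet> ((A - m *\<^sub>R mat 1) *v v)" "0 \<le> v \<bullet> ((M *\<^sub>R mat 1 - A) *v v)"
    using assms(1,2) unfolding loewner_le_def positive_matrix_iff_form by blast+
  then have "0 \<le> (t - m) * (v \<bullet> v)" "0 \<le> (M - t) * (v \<bullet> v)"
    by (simp_all add: matrix_vector_mult_diff_rdistrib matrix_vector_scaleR tv algebra_simps)
  moreover have "0 < v \<bullet> v" using v by simp
  ultimately show ?thesis
    by (simp add: zero_le_mult_iff del: inner_gt_zero_iff)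
qed

text \<open>
The matrices \<open>P j\<close> are the rank-one projections onto the columns of a diagonalising unitary matrix.
They do not depend on \<open>h\<close>, which is what lets different functions of \<open>A\<close> be compared
coefficientwise.
\<close>
lemma spectral_resolution:
  fixes A :: "complex^'n^'n"
  assumes A: "m *\<^sub>R mat 1 \<preceq> A" "A \<preceq> M *\<^sub>R mat 1"
  obtains d :: "'n \<Rightarrow> real" and P where
    "\<And>j. d j \<in> {m..M}" "\<And>j. positive_matrix (P j)"
    "(\<Sum>j\<in>UNIV. P j) = mat 1" "A = (\<Sum>j\<in>UNIV. d j *\<^sub>R P j)"
    "\<And>h. matrix_fun h A = (\<Sum>j\<in>UNIV. h (d j) *\<^sub>R P j)"
proof -
  obtain U d where U: "unitary_matrix U" and UA: "A = U ** diag_matrix d ** cadjoint U"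
    using hermitian_diagonalizable[OF hermitian_if_above_scalar[OF A(1)]] .
  define E :: "'n \<Rightarrow> complex^'n^'n" where "E = (\<lambda>j. diag_matrix (\<lambda>i. if i = j then 1 else 0))"
  define P where "P = (\<lambda>j. U ** E j ** cadjoint U)"
  have sum_P: "U ** diag_matrix h ** cadjoint U = (\<Sum>j\<in>UNIV. h j *\<^sub>R P j)" for h
  proof -
    have "diag_matrix h $ i $ l = (\<Sum>j\<in>UNIV. h j *\<^sub>R E j) $ i $ l" for i l
    proof (cases "i = l")
      case True
      have "(\<Sum>j\<in>UNIV. h j *\<^sub>R E j) $ i $ l = (\<Sum>j\<in>UNIV. if i = j then complex_of_real (h j) else 0)"
        unfolding sum_component by (intro sum.cong) (auto simp: E_def diag_matrix_def True scaleR_conv_of_real[where 'a=complex])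
      then show ?thesis by (simp add: diag_matrix_def True)
    qed (simp add: E_def diag_matrix_def)
    then have "diag_matrix h = (\<Sum>j\<in>UNIV. h j *\<^sub>R E j)"
      by (simp add: vec_eq_iff)
    moreover have "U ** (\<Sum>j\<in>S. h j *\<^sub>R E j) ** cadjoint U = (\<Sum>j\<in>S. h j *\<^sub>R P j)" for S
      by (induction S rule: infinite_finite_induct)
        (simp_all add: P_def matrix_add_ldistrib matrix_add_rdistrib matrix_scalar_ac flip: scalar_matrix_assoc)
    ultimately show ?thesis by simp
  qed
  show thesis
  proof (rule that)
    show "d j \<in> {m..M}" for j
      using eigenvalue_diagonalized[OF U, of d j] unfolding UA[symmetric] by (rule eigenvalue_bounds[OF A])
    show "positive_matrix (P j)" for j
      by (simp add: positive_matrix_iff_form P_def E_def hermitian_conjugate hermitian_diag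
          conjugate_inner diag_inner_nonneg)
    have "diag_matrix (\<lambda>_. 1) = (mat 1 :: complex^'n^'n)"
      by (simp add: vec_eq_iff diag_matrix_def mat_def)
    then show "(\<Sum>j\<in>UNIV. P j) = mat 1"
      using sum_P[of "\<lambda>_. 1"] U by (simp add: unitary_matrix_def)
    show "A = (\<Sum>j\<in>UNIV. d j *\<^sub>R P j)"
      by (simp add: UA sum_P)
    show "matrix_fun h A = (\<Sum>j\<in>UNIV. h (d j) *\<^sub>R P j)" for h
      unfolding UA matrix_fun_diagonalized[OF U] by (simp add: sum_P)
  qed
qed

section \<open>Positive multilinear maps\<close>

lemma multilinear_add: "multilinear_map \<Phi> \<Longrightarrow> \<Phi> (A(i := X + Y)) = \<Phi> (A(i := X)) + \<Phi> (A(i := Y))"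
  by (simp add: multilinear_map_def)

lemma multilinear_scaleR:
  assumes "multilinear_map \<Phi>"
  shows "\<Phi> (A(i := c *\<^sub>R X)) = c *\<^sub>R \<Phi> (A(i := X))"
proof -
  have *: "c *\<^sub>R X = cscale (complex_of_real c) X" for X :: "complex^'r^'r"
    by (simp add: cscale_def vec_eq_iff scaleR_conv_of_real[where 'a=complex])
  show ?thesis
    using assms unfolding * multilinear_map_def by blast
qed

lemma multilinear_sum:
  assumes "multilinear_map \<Phi>" "finite S"
  shows "\<Phi> (A(i := \<Sum>j\<in>S. c j *\<^sub>R X j)) = (\<Sum>j\<in>S. c j *\<^sub>R \<Phi> (A(i := X j)))"
  using assms(2)
proof (induction S)
  case empty
  have "\<Phi> (A(i := 0)) = 0"
    using multilinear_scaleR[OF assms(1), of A i 0 0] by simp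
  then show ?case by (simp only: sum.empty)
next
  case (insert j S)
  then show ?case
    by (simp only: sum.insert[OF insert.hyps] multilinear_add[OF assms(1)] multilinear_scaleR[OF assms(1)])
qed

text \<open>
The variables are expanded one at a time: for a set \<open>K\<close> of variables, those outside \<open>K\<close> keep
arbitrary values \<open>B\<close>. The induction hypothesis is applied with one more component of \<open>B\<close> set to
a full sum.
\<close>
lemma multilinear_expand:
  fixes \<Phi> :: "('k::finite \<Rightarrow> complex^'q^'q) \<Rightarrow> complex^'p^'p" and P :: "'k \<Rightarrow> 'j::finite \<Rightarrow> complex^'q^'q"
  assumes \<Phi>: "multilinear_map \<Phi>"
  shows "\<Phi> (\<lambda>i. \<Sum>j\<in>UNIV. c i j *\<^sub>R P i j) =
    (\<Sum>g\<in>UNIV. (\<Prod>i\<in>UNIV. c i (g i)) *\<^sub>R \<Phi> (\<lambda>i. P i (g i)))"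
proof -
  have "\<Phi> (\<lambda>i. if i \<in> K then \<Sum>j\<in>UNIV. c i j *\<^sub>R P i j else B i) =
    (\<Sum>g\<in>PiE K (\<lambda>_. UNIV). (\<Prod>i\<in>K. c i (g i)) *\<^sub>R \<Phi> (\<lambda>i. if i \<in> K then P i (g i) else B i))" for K B
  proof -
    have "finite K" by simp
    then show ?thesis
    proof (induction K arbitrary: B)
      case empty
      show ?case by simp
    next
      case (insert l K)
      let ?S = "\<lambda>i. \<Sum>j\<in>UNIV. c i j *\<^sub>R P i j"
      let ?F = "\<lambda>g. (\<Prod>i\<in>insert l K. c i (g i)) *\<^sub>R \<Phi> (\<lambda>i. if i \<in> insert l K then P i (g i) else B i)"
      have upd: "(\<lambda>i. if i \<in> insert l K then ?S i else B i) =
          (\<lambda>i. if i \<in> K then ?S i else (B(l := ?S l)) i)"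
        using insert.hyps by auto
      have "\<Phi> (\<lambda>i. if i \<in> insert l K then ?S i else B i) =
          (\<Sum>g\<in>PiE K (\<lambda>_. UNIV). (\<Prod>i\<in>K. c i (g i)) *\<^sub>R
            \<Phi> ((\<lambda>i. if i \<in> K then P i (g i) else B i)(l := ?S l)))"
        unfolding upd insert.IH using insert.hyps
        by (intro sum.cong refl arg_cong2[of _ _ _ _ "(*\<^sub>R)"] arg_cong[of _ _ \<Phi>]) auto
      also have "\<dots> = (\<Sum>g\<in>PiE K (\<lambda>_. UNIV). \<Sum>j\<in>UNIV. ?F (g(l := j)))"
      proof (intro sum.cong refl)
        fix g :: "'k \<Rightarrow> 'j"
        have "(\<lambda>i. if i \<in> K then P i (g i) else B i)(l := P l j) =
            (\<lambda>i. if i \<in> insert l K then P i ((g(l := j)) i) else B i)" for j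
          using insert.hyps by auto
        moreover have "(\<Prod>i\<in>insert l K. c i ((g(l := j)) i)) = (\<Prod>i\<in>K. c i (g i)) * c l j" for j
        proof -
          have "(\<Prod>i\<in>K. c i ((g(l := j)) i)) = (\<Prod>i\<in>K. c i (g i))"
            using insert.hyps by (intro prod.cong) auto
          then show ?thesis using insert.hyps by simp
        qed
        ultimately show "(\<Prod>i\<in>K. c i (g i)) *\<^sub>R
            \<Phi> ((\<lambda>i. if i \<in> K then P i (g i) else B i)(l := ?S l)) = (\<Sum>j\<in>UNIV. ?F (g(l := j)))"
          by (simp only: multilinear_sum[OF \<Phi> finite_class.finite_UNIV] scaleR_sum_right scaleR_scaleR)
      qed
      also have "\<dots> = (\<Sum>(j, g)\<in>UNIV \<times> PiE K (\<lambda>_. UNIV). ?F (g(l := j)))"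
        by (subst sum.swap) (simp add: sum.cartesian_product)
      also have "\<dots> = (\<Sum>g\<in>PiE (insert l K) (\<lambda>_. UNIV). ?F g)"
        unfolding PiE_insert_eq using insert.hyps
        by (subst sum.reindex[OF inj_combinator]) (auto simp: case_prod_unfold)
      finally show ?case .
    qed
  qed
  from this[of UNIV] show ?thesis by simp
qed

text \<open>
The joint counterpart of \<open>spectral_resolution\<close> for a tuple of matrices seen through \<open>\<Phi>\<close>: products of
eigenvalues take the place of eigenvalues, and the weights \<open>Q g\<close> are the values of \<open>\<Phi>\<close> on tuples of
spectral projections.
\<close>
lemma multilinear_resolution:
  fixes A :: "'k::finite \<Rightarrow> complex^'q^'q"
    and \<Phi> :: "('k \<Rightarrow> complex^'q^'q) \<Rightarrow> complex^'p^'p"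
  assumes A: "\<And>i. m *\<^sub>R mat 1 \<preceq> A i" "\<And>i. A i \<preceq> M *\<^sub>R mat 1"
    and \<Phi>: "multilinear_map \<Phi>" "positive_map \<Phi>" "unital_map \<Phi>"
  obtains D :: "('k \<Rightarrow> 'q) \<Rightarrow> 'k \<Rightarrow> real" and Q where
    "\<And>g i. D g i \<in> {m..M}" "\<And>g. positive_matrix (Q g)" "(\<Sum>g\<in>UNIV. Q g) = mat 1"
    "\<Phi> A = (\<Sum>g\<in>UNIV. (\<Prod>i\<in>UNIV. D g i) *\<^sub>R Q g)"
    "\<And>f. \<Phi> (\<lambda>i. matrix_fun f (A i)) = (\<Sum>g\<in>UNIV. (\<Prod>i\<in>UNIV. f (D g i)) *\<^sub>R Q g)"
proof -
  \<comment> \<open>Naming the relation leaves an opaque statement from which \<open>d\<close> and \<open>P\<close> are chosen for all \<open>i\<close>.\<close>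
  define resolves where "resolves = (\<lambda>i (d :: 'q \<Rightarrow> real) P. (\<forall>j. d j \<in> {m..M}) \<and> (\<forall>j. positive_matrix (P j)) \<and>
      (\<Sum>j\<in>UNIV. P j) = mat 1 \<and> A i = (\<Sum>j\<in>UNIV. d j *\<^sub>R P j) \<and>
      (\<forall>h. matrix_fun h (A i) = (\<Sum>j\<in>UNIV. h (d j) *\<^sub>R P j)))"
  have "\<exists>d P. resolves i d P" for i
    unfolding resolves_def by (rule spectral_resolution[OF A(1)[of i] A(2)[of i]]) blast
  then obtain d :: "'k \<Rightarrow> 'q \<Rightarrow> real" and P where "\<And>i. resolves i (d i) (P i)"
    by metis
  then have d: "d i j \<in> {m..M}" and P: "positive_matrix (P i j)"
    and P1: "(\<Sum>j\<in>UNIV. P i j) = mat 1" and AP: "A i = (\<Sum>j\<in>UNIV. d i j *\<^sub>R P i j)"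
    and fP: "matrix_fun h (A i) = (\<Sum>j\<in>UNIV. h (d i j) *\<^sub>R P i j)" for i j h
    unfolding resolves_def by blast+
  show thesis
  proof (rule that[of "\<lambda>g i. d i (g i)" "\<lambda>g. \<Phi> (\<lambda>i. P i (g i))"])
    show "positive_matrix (\<Phi> (\<lambda>i. P i (g i)))" for g
      using \<Phi>(2) P by (simp add: positive_map_def)
    show "(\<Sum>g\<in>UNIV. \<Phi> (\<lambda>i. P i (g i))) = mat 1"
      using multilinear_expand[OF \<Phi>(1), of "\<lambda>_ _. 1" P] \<Phi>(3) by (simp add: P1 unital_map_def)
    show "\<Phi> A = (\<Sum>g\<in>UNIV. (\<Prod>i\<in>UNIV. d i (g i)) *\<^sub>R \<Phi> (\<lambda>i. P i (g i)))"
      using multilinear_expand[OF \<Phi>(1), of d P] by (simp flip: AP)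
    show "\<Phi> (\<lambda>i. matrix_fun f (A i)) = (\<Sum>g\<in>UNIV. (\<Prod>i\<in>UNIV. f (d i (g i))) *\<^sub>R \<Phi> (\<lambda>i. P i (g i)))" for f
      unfolding fP by (rule multilinear_expand[OF \<Phi>(1)])
  qed (use d in auto)
qed

section \<open>Scalar inequalities\<close>

lemma prod_between_powers:
  fixes x :: "'i \<Rightarrow> real"
  assumes "0 < m" "\<And>i. i \<in> S \<Longrightarrow> x i \<in> {m..M}"
  shows "prod x S \<in> {m ^ card S..M ^ card S}"
proof -
  have "(\<Prod>i\<in>S. m) \<le> prod x S"
    using assms by (intro prod_mono) auto
  moreover have "prod x S \<le> (\<Prod>i\<in>S. M)"
    using assms by (intro prod_mono) force
  ultimately show ?thesis by simp
qed

text \<open>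
Since \<open>c ^ n\<close> is increasing or decreasing in \<open>n\<close>, each of the powers \<open>m ^ card S\<close> and \<open>M ^ card S\<close> lies between the
first and the \<open>k\<close>-th power of its base, and all of these are in \<open>J\<close>.
\<close>
lemma prod_mem_interval:
  fixes x :: "'i \<Rightarrow> real"
  assumes m: "0 < m" and x: "\<And>i. i \<in> S \<Longrightarrow> x i \<in> {m..M}" and S: "finite S" "S \<noteq> {}" "card S \<le> k"
    and J: "is_interval J" "{m..M} \<subseteq> J" "{m ^ k..M ^ k} \<subseteq> J"
  shows "prod x S \<in> J"
proof -
  have mM: "m \<le> M"
    using x S by fastforce
  have card: "1 \<le> card S"
    using S by (simp add: Suc_le_eq card_gt_0_iff)
  have between: "\<exists>a\<in>{c, c ^ k}. a \<le> c ^ card S" "\<exists>b\<in>{c, c ^ k}. c ^ card S \<le> b" if "0 < c" for c :: real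
  proof -
    show "\<exists>a\<in>{c, c ^ k}. a \<le> c ^ card S"
    proof (cases "1 \<le> c")
      case True
      then show ?thesis using power_increasing[OF card True] by simp
    next
      case False
      then show ?thesis using power_decreasing[OF S(3), of c] that by simp
    qed
    show "\<exists>b\<in>{c, c ^ k}. c ^ card S \<le> b"
    proof (cases "1 \<le> c")
      case True
      then show ?thesis using power_increasing[OF S(3) True] by simp
    next
      case False
      then show ?thesis using power_decreasing[OF card, of c] that by simp
    qed
  qed
  have mk: "m ^ k \<le> M ^ k"
    using m mM by (intro power_mono) auto
  obtain a where a: "a \<in> J" "a \<le> m ^ card S"
    using between(1)[of m] J(2,3) mM mk m by auto
  obtain b where b: "b \<in> J" "M ^ card S \<le> b"
    using between(2)[of M] J(2,3) mM mk m by auto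
  have "prod x S \<in> {m ^ card S..M ^ card S}"
    using prod_between_powers[OF m] x by blast
  then show ?thesis
    using a b by (intro mem_is_interval_1_I[OF J(1) a(1) b(1)]) auto
qed

text \<open>
Multiplying in a factor \<open>f (x i)\<close> preserves a lower bound only if the factor is nonnegative. When
all factors are negative there is an even number of them, and two at a time can be multiplied in,
because \<open>f (x i * x j) \<ge> f (x i) * f (x j) > 0\<close>.
\<close>
lemma super_multiplicative_prod:
  fixes x :: "'i \<Rightarrow> real"
  assumes f: "super_multiplicative_on J f" and "finite S" "S \<noteq> {}"
    and J: "\<And>T. T \<subseteq> S \<Longrightarrow> T \<noteq> {} \<Longrightarrow> prod x T \<in> J"
    and pos: "0 < (\<Prod>i\<in>S. f (x i))"
  shows "(\<Prod>i\<in>S. f (x i)) \<le> f (prod x S)"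
  using assms(2-)
proof (induction S rule: finite_psubset_induct)
  case (psubset S)
  have mult: "f a * f b \<le> f (a * b)" if "a \<in> J" "b \<in> J" for a b
    using f that by (simp add: super_multiplicative_on_def)
  have xJ: "x i \<in> J" if "i \<in> S" for i
    using psubset.prems(2)[of "{i}"] that by simp
  have nz: "f (x i) \<noteq> 0" if "i \<in> S" for i
    using psubset.prems(3) psubset.hyps that by (metis less_irrefl prod_zero)
  have IH: "(\<Prod>i\<in>T. f (x i)) \<le> f (prod x T)" if "T \<subset> S" "T \<noteq> {}" "0 < (\<Prod>i\<in>T. f (x i))" for T
    using psubset.IH[OF that(1,2)] psubset.prems(2) that by (meson order_trans psubset_imp_subset)
  show ?case
  proof (cases "\<exists>i\<in>S. 0 < f (x i)")
    case True
    then obtain i where i: "i \<in> S" "0 < f (x i)" by blast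
    define T where "T = S - {i}"
    have S: "S = insert i T" "i \<notin> T" "finite T"
      using i psubset.hyps by (auto simp: T_def)
    show ?thesis
    proof (cases "T = {}")
      case False
      have T: "0 < (\<Prod>i\<in>T. f (x i))"
        using psubset.prems(3) i S by (simp add: zero_less_mult_iff)
      have "f (x i) * (\<Prod>i\<in>T. f (x i)) \<le> f (x i) * f (prod x T)"
        using IH[of T] S False T i by (intro mult_left_mono) auto
      also have "\<dots> \<le> f (x i * prod x T)"
        using S False psubset.prems(2)[of T] xJ i by (intro mult) auto
      finally show ?thesis using S by simp
    qed (simp add: S)
  next
    case False
    then have neg: "f (x i) < 0" if "i \<in> S" for i
      using nz[OF that] that by force
    obtain i where i: "i \<in> S" using psubset.prems(1) by blast
    have "S \<noteq> {i}"
      using psubset.prems(3) neg[OF i] by auto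
    then obtain j where j: "j \<in> S" "j \<noteq> i" using i by blast
    define T where "T = S - {i, j}"
    have S: "S = insert i (insert j T)" "i \<notin> insert j T" "j \<notin> T" "finite T"
      using i j psubset.hyps by (auto simp: T_def)
    have ij: "f (x i) * f (x j) \<le> f (x i * x j)"
      using mult xJ i j by blast
    have ij_pos: "0 < f (x i) * f (x j)"
      using neg i j by (simp add: mult_neg_neg)
    show ?thesis
    proof (cases "T = {}")
      case True
      then show ?thesis using ij S by simp
    next
      case False
      have T: "0 < (\<Prod>i\<in>T. f (x i))"
        using psubset.prems(3) S ij_pos
        by (simp add: mult.assoc[symmetric] zero_less_mult_iff[of "f (x i) * f (x j)"])
      have ijJ: "x i * x j \<in> J"
        using psubset.prems(2)[of "{i, j}"] i j by simp
      have "f (x i) * f (x j) * (\<Prod>i\<in>T. f (x i)) \<le> f (x i * x j) * f (prod x T)"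
        using IH[of T] S False T ij ij_pos by (intro mult_mono) auto
      also have "\<dots> \<le> f (x i * x j * prod x T)"
        using S False psubset.prems(2)[of T] ijJ by (intro mult) auto
      finally show ?thesis using S by (simp add: mult.assoc)
    qed
  qed
qed

lemma sub_multiplicative_prod:
  fixes x :: "'i \<Rightarrow> real"
  assumes f: "sub_multiplicative_on J f" and "finite S" "S \<noteq> {}"
    and J: "\<And>T. T \<subseteq> S \<Longrightarrow> T \<noteq> {} \<Longrightarrow> prod x T \<in> J"
    and nonneg: "\<And>i. i \<in> S \<Longrightarrow> 0 \<le> f (x i)"
  shows "f (prod x S) \<le> (\<Prod>i\<in>S. f (x i))"
  using assms(2-)
proof (induction S rule: finite_ne_induct)
  case (singleton i)
  show ?case by simp
next
  case (insert i S)
  have "f (x i * prod x S) \<le> f (x i) * f (prod x S)"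
    using f insert.prems(1)[of "{i}"] insert.prems(1)[of S] insert.hyps
    by (auto simp: sub_multiplicative_on_def)
  also have "\<dots> \<le> f (x i) * (\<Prod>i\<in>S. f (x i))"
    using insert by (intro mult_left_mono insert.IH) auto
  finally show ?case using insert.hyps by simp
qed

text \<open>
By compactness the quotient \<open>L / f\<close> is bounded on \<open>[a, b]\<close>, so the supremum and the infimum in
the two constants really bound it.
\<close>
lemma chord_ratio_bounds:
  assumes "continuous_on {a..b} f" "\<And>t. t \<in> {a..b} \<Longrightarrow> 0 < f t" "t \<in> {a..b}"
  defines "L \<equiv> \<lambda>t. (f b - f a) / (b - a) * (t - a) + f a"
  shows "L t \<le> alpha_const a b f * f t" "beta_const a b f * f t \<le> L t"
proof -
  define r where "r = (\<lambda>t. 1 / f t * L t)"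
  have "continuous_on {a..b} r"
    unfolding r_def L_def using assms(1,2) by (intro continuous_intros) force+
  then have "bounded (r ` {a..b})"
    by (intro compact_imp_bounded compact_continuous_image) auto
  then have "r t \<le> alpha_const a b f" "beta_const a b f \<le> r t"
    unfolding alpha_const_def beta_const_def r_def L_def
    using assms(3) by (auto intro!: cSUP_upper cINF_lower dest: bounded_imp_bdd_above bounded_imp_bdd_below)
  then show "L t \<le> alpha_const a b f * f t" "beta_const a b f * f t \<le> L t"
    using assms(2)[OF assms(3)] by (simp_all add: r_def field_simps)
qed

section \<open>Comparison through the chord\<close>

theorem theorem5p2:
  fixes A :: "'k::finite \<Rightarrow> complex^'q^'q"
    and \<Phi> :: "('k \<Rightarrow> complex^'q^'q) \<Rightarrow> complex^'p^'p"
    and f :: "real \<Rightarrow> real"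
    and m M :: real
    and k :: nat
    and J :: "real set"
  assumes k: "k = CARD('k)"
    and mM: "0 < m" "m < M"
    and A_pos: "\<And>i. positive_matrix (A i)"
    and A_bounds: "\<And>i. m *\<^sub>R mat 1 \<preceq> A i" "\<And>i. A i \<preceq> M *\<^sub>R mat 1"
    and \<Phi>: "multilinear_map \<Phi>" "positive_map \<Phi>" "unital_map \<Phi>"
    and J: "is_interval J" "{m..M} \<subseteq> J" "{m ^ k..M ^ k} \<subseteq> J"
    and f_cont: "continuous_on J f"
    and f_pos: "\<And>t. t \<in> {m ^ k..M ^ k} \<Longrightarrow> 0 < f t"
  shows "(super_multiplicative_on J f \<and> convex_on J f \<longrightarrow>
           \<Phi> (\<lambda>i. matrix_fun f (A i)) \<preceq>
             alpha_const (m ^ k) (M ^ k) f *\<^sub>R matrix_fun f (\<Phi> A))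
       \<and> (sub_multiplicative_on J f \<and> concave_on J f \<and> (\<forall>t\<in>{m..M}. 0 \<le> f t) \<longrightarrow>
           beta_const (m ^ k) (M ^ k) f *\<^sub>R matrix_fun f (\<Phi> A) \<preceq>
             \<Phi> (\<lambda>i. matrix_fun f (A i)))"
proof -
  let ?a = "m ^ k" and ?b = "M ^ k"
  define s where "s = (f ?b - f ?a) / (?b - ?a)"
  define L where "L = (\<lambda>t. s * (t - ?a) + f ?a)"
  obtain D :: "('k \<Rightarrow> 'q) \<Rightarrow> 'k \<Rightarrow> real" and Q where D: "\<And>g i. D g i \<in> {m..M}" and Q: "\<And>g. positive_matrix (Q g)"
    and Q1: "(\<Sum>g\<in>UNIV. Q g) = mat 1"
    and \<Phi>A: "\<Phi> A = (\<Sum>g\<in>UNIV. (\<Prod>i\<in>UNIV. D g i) *\<^sub>R Q g)"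
    and \<Phi>f: "\<And>f. \<Phi> (\<lambda>i. matrix_fun f (A i)) = (\<Sum>g\<in>UNIV. (\<Prod>i\<in>UNIV. f (D g i)) *\<^sub>R Q g)"
    by (rule multilinear_resolution[of m A M, OF A_bounds \<Phi>]) (rule that)
  have prod_ab: "(\<Prod>i\<in>UNIV. D g i) \<in> {?a..?b}" for g
    using prod_between_powers[OF mM(1), of UNIV "D g" M] D by (simp add: k)
  have prod_J: "prod (D g) T \<in> J" if "T \<noteq> {}" for g T
    using D k that card_mono[of UNIV T] by (intro prod_mem_interval[OF mM(1) _ _ _ _ J]) auto
  have const: "(\<Sum>g\<in>UNIV. c *\<^sub>R Q g) = c *\<^sub>R mat 1" for c
    by (simp add: Q1 flip: scaleR_sum_right)
  have \<Phi>A_bounds: "?a *\<^sub>R mat 1 \<preceq> \<Phi> A" "\<Phi> A \<preceq> ?b *\<^sub>R mat 1"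
    unfolding \<Phi>A const[symmetric] using prod_ab by (auto intro!: loewner_le_sum Q)
  obtain e :: "'p \<Rightarrow> real" and R where e: "\<And>j. e j \<in> {?a..?b}" and R: "\<And>j. positive_matrix (R j)"
    and R1: "(\<Sum>j\<in>UNIV. R j) = mat 1" and eR: "\<Phi> A = (\<Sum>j\<in>UNIV. e j *\<^sub>R R j)"
    and fR: "\<And>h. matrix_fun h (\<Phi> A) = (\<Sum>j\<in>UNIV. h (e j) *\<^sub>R R j)"
    by (rule spectral_resolution[OF \<Phi>A_bounds]) (rule that)
  have affine: "(\<Sum>i\<in>UNIV. L (c i) *\<^sub>R B i) = s *\<^sub>R (\<Sum>i\<in>UNIV. c i *\<^sub>R B i) + (f ?a - s * ?a) *\<^sub>R mat 1"
    if "(\<Sum>i\<in>UNIV. B i) = mat 1" for c and B :: "'i::finite \<Rightarrow> complex^'p^'p"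
  proof -
    have "L (c i) *\<^sub>R B i = s *\<^sub>R c i *\<^sub>R B i + (f ?a - s * ?a) *\<^sub>R B i" for i
      by (simp add: L_def algebra_simps)
    then show ?thesis
      by (simp only: sum.distrib scaleR_sum_right[symmetric] that)
  qed
  \<comment> \<open>Both sums are \<open>L\<close> applied to \<open>\<Phi> A\<close>, the left one without passing to its eigenvalues.\<close>
  have middle: "(\<Sum>g\<in>UNIV. L (\<Prod>i\<in>UNIV. D g i) *\<^sub>R Q g) = (\<Sum>j\<in>UNIV. L (e j) *\<^sub>R R j)"
    unfolding affine[OF Q1] affine[OF R1] using \<Phi>A eR by simp
  have f_cont_ab: "continuous_on {?a..?b} f"
    using f_cont J(3) by (rule continuous_on_subset)
  show ?thesis
  proof (intro conjI impI; elim conjE)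
    assume super: "super_multiplicative_on J f" and conv: "convex_on J f"
    have "(\<Prod>i\<in>UNIV. f (D g i)) \<le> L (\<Prod>i\<in>UNIV. D g i)" for g
    proof -
      have "(\<Prod>i\<in>UNIV. f (D g i)) \<le> f (\<Prod>i\<in>UNIV. D g i)"
      \<comment> \<open>A nonpositive product is below \<open>f\<close>, which is positive on \<open>[m ^ k, M ^ k]\<close>.\<close>
      proof (cases "0 < (\<Prod>i\<in>UNIV. f (D g i))")
        case True
        then show ?thesis
          by (intro super_multiplicative_prod[OF super] prod_J) auto
      next
        case False
        then show ?thesis using f_pos[OF prod_ab, of g] by simp
      qed
      also have "\<dots> \<le> L (\<Prod>i\<in>UNIV. D g i)"
        unfolding L_def s_def
        by (intro convex_onD_Icc' convex_on_subset[OF conv] J(3) prod_ab convex_real_interval)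
      finally show ?thesis .
    qed
    then have "\<Phi> (\<lambda>i. matrix_fun f (A i)) \<preceq> (\<Sum>g\<in>UNIV. L (\<Prod>i\<in>UNIV. D g i) *\<^sub>R Q g)"
      unfolding \<Phi>f by (intro loewner_le_sum Q)
    moreover have "(\<Sum>j\<in>UNIV. L (e j) *\<^sub>R R j) \<preceq> (\<Sum>j\<in>UNIV. (alpha_const ?a ?b f * f (e j)) *\<^sub>R R j)"
      unfolding L_def s_def by (intro loewner_le_sum R chord_ratio_bounds f_cont_ab f_pos e)
    ultimately show "\<Phi> (\<lambda>i. matrix_fun f (A i)) \<preceq> alpha_const ?a ?b f *\<^sub>R matrix_fun f (\<Phi> A)"
      unfolding middle fR scaleR_sum_right scaleR_scaleR by (rule loewner_le_trans)
  next
    assume sub: "sub_multiplicative_on J f" and conc: "concave_on J f" and f0: "\<forall>t\<in>{m..M}. 0 \<le> f t"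
    have "L (\<Prod>i\<in>UNIV. D g i) \<le> (\<Prod>i\<in>UNIV. f (D g i))" for g
    proof -
      have "concave_on {?a..?b} f"
        using conc J(3) convex_on_subset[of J "\<lambda>x. - f x"] by (simp add: concave_on_def)
      then have "L (\<Prod>i\<in>UNIV. D g i) \<le> f (\<Prod>i\<in>UNIV. D g i)"
        unfolding L_def s_def by (intro concave_onD_Icc' prod_ab)
      also have "\<dots> \<le> (\<Prod>i\<in>UNIV. f (D g i))"
        using f0 D by (intro sub_multiplicative_prod[OF sub] prod_J) auto
      finally show ?thesis .
    qed
    then have "(\<Sum>g\<in>UNIV. L (\<Prod>i\<in>UNIV. D g i) *\<^sub>R Q g) \<preceq> \<Phi> (\<lambda>i. matrix_fun f (A i))"
      unfolding \<Phi>f by (intro loewner_le_sum Q)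
    moreover have "(\<Sum>j\<in>UNIV. (beta_const ?a ?b f * f (e j)) *\<^sub>R R j) \<preceq> (\<Sum>j\<in>UNIV. L (e j) *\<^sub>R R j)"
      unfolding L_def s_def by (intro loewner_le_sum R chord_ratio_bounds f_cont_ab f_pos e)
    ultimately show "beta_const ?a ?b f *\<^sub>R matrix_fun f (\<Phi> A) \<preceq> \<Phi> (\<lambda>i. matrix_fun f (A i))"
      unfolding middle fR scaleR_sum_right scaleR_scaleR by (rule loewner_le_trans[rotated])
  qed
qed

end
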